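(* Let $G$ be a simple connected graph with $n\geq 3$ vertices and $m$ edges, let $M_1=M_1(G)$, and let $a\in\mathbb{R}\setminus\{0,1\}$. (1) If $a<0$ or $a>1$, then $KB^a(G)\geq n^{1-a}(2M_1-4m)^a$. (2) If $0<a<1$, then $KB^a(G)\leq n^{1-a}(2M_1-4m)^a$. In both parts, equality holds if $S_e(v)$ is the same for every vertex $v$ of $G$.
   Context: Graphs are finite. For a simple graph $G$ with vertex set $V(G)$ and edge set $E(G)$, $d(u)$ denotes the degree of a vertex $u$. The degree of an edge $e=uv$ is $d_G(e)=d(u)+d(v)-2$. The edge neighborhood degree $S_e(v)$ of a vertex $v$ is the sum of the degrees $d_G(e)$ of all edges $e$ incident to $v$. The first Zagreb index is $M_1(G)=\sum_{u\in V(G)}d(u)^2$. For real $a\neq 0,1$, the general Kulli-Basava index is $KB^a(G)=\sum_{v\in V(G)}S_e(v)^a$. *)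

theory Defs
  imports Complex_Main
begin

definition simple_graph :: "'a set \<Rightarrow> 'a set set \<Rightarrow> bool" where
  "simple_graph V E \<longleftrightarrow> finite V \<and> (\<forall>e\<in>E. e \<subseteq> V \<and> card e = 2)"

definition adj_rel :: "'a set set \<Rightarrow> ('a \<times> 'a) set" where
  "adj_rel E = {(u, v). {u, v} \<in> E}"

definition connected_graph :: "'a set \<Rightarrow> 'a set set \<Rightarrow> bool" where
  "connected_graph V E \<longleftrightarrow> V \<noteq> {} \<and> (\<forall>u\<in>V. \<forall>v\<in>V. (u, v) \<in> (adj_rel E)\<^sup>*)"

definition degree :: "'a set set \<Rightarrow> 'a \<Rightarrow> nat" where
  "degree E u = card {e \<in> E. u \<in> e}"

text \<open>For \<open>e = {u, v}\<close> with \<open>u \<noteq> v\<close> the sum is \<open>d(u) + d(v)\<close>; the values are integers so that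
  the subtraction is not truncated.\<close>

definition edge_degree :: "'a set set \<Rightarrow> 'a set \<Rightarrow> int" where
  "edge_degree E e = (\<Sum>u\<in>e. int (degree E u)) - 2"

definition edge_nbhd_degree :: "'a set set \<Rightarrow> 'a \<Rightarrow> int" where
  "edge_nbhd_degree E v = (\<Sum>e\<in>{e \<in> E. v \<in> e}. edge_degree E e)"

definition first_zagreb :: "'a set \<Rightarrow> 'a set set \<Rightarrow> nat" where
  "first_zagreb V E = (\<Sum>u\<in>V. (degree E u)\<^sup>2)"

text \<open>In a connected simple graph with at least three vertices every \<open>S\<^sub>e(v)\<close> is positive,
  so \<open>powr\<close> is the ordinary real power there.\<close>

definition general_kulli_basava :: "real \<Rightarrow> 'a set \<Rightarrow> 'a set set \<Rightarrow> real" where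
  "general_kulli_basava a V E = (\<Sum>v\<in>V. real_of_int (edge_nbhd_degree E v) powr a)"

end

theory Submission imports Defs "HOL-Analysis.Convex"
begin

text \<open>
  Let \<open>S(v)\<close> be the edge neighbourhood degree of \<open>v\<close>. Summing \<open>S\<close> over all vertices counts
  the degree of every edge once at each of its two ends; since the vertex \<open>u\<close> contributes
  \<open>d(u)\<close> to each of its \<open>d(u)\<close> edges, the edge degrees sum to \<open>M\<^sub>1 - 2m\<close>, and so
  \<open>(\<Sum>v. S(v)) = 2M\<^sub>1 - 4m\<close> (lemma \<open>sum_edge_nbhd_degree\<close>). The two bounds are then Jensen's
  inequality for \<open>x \<mapsto> x\<^sup>a\<close>, which on the positive reals is convex for \<open>a < 0\<close> or \<open>a > 1\<close> and
  concave for \<open>0 < a < 1\<close>: the mean of the \<open>S(v)\<^sup>a\<close> is compared with the \<open>a\<close>-th power of the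
  mean \<open>(2M\<^sub>1 - 4m)/n\<close>. If \<open>S\<close> is constant, every \<open>S(v)\<close> equals the mean.

  Jensen's inequality needs all \<open>S(v)\<close> to be positive, and this is where connectedness and
  \<open>n \<ge> 3\<close> enter: an edge of degree \<open>0\<close> would be a whole component with two vertices, and an
  isolated vertex would be a component of its own (lemma \<open>edge_nbhd_degree_pos\<close>).
\<close>

section \<open>Power sums of positive reals\<close>

lemma powr_has_second_derivative:
  fixes a x :: real
  assumes "x > 0"
  shows "((\<lambda>x. x powr a) has_real_derivative a * x powr (a - 1)) (at x)"
    and "((\<lambda>x. a * x powr (a - 1)) has_real_derivative a * (a - 1) * x powr (a - 2)) (at x)"
proof -
  show "((\<lambda>x. x powr a) has_real_derivative a * x powr (a - 1)) (at x)"
    using assms by (auto intro!: derivative_eq_intros)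
  show "((\<lambda>x. a * x powr (a - 1)) has_real_derivative a * (a - 1) * x powr (a - 2)) (at x)"
    using assms by (auto intro!: derivative_eq_intros)
qed

lemma convex_on_powr:
  fixes a :: real
  assumes "a < 0 \<or> a > 1"
  shows "convex_on {0<..} (\<lambda>x. x powr a)"
proof (rule f''_ge0_imp_convex[OF _ powr_has_second_derivative])
  show "0 \<le> a * (a - 1) * x powr (a - 2)" for x :: real
    using assms by (intro mult_nonneg_nonneg[of "a * (a - 1)"]) (auto simp: zero_le_mult_iff)
qed auto

lemma concave_on_powr:
  fixes a :: real
  assumes "0 < a" "a < 1"
  shows "concave_on {0<..} (\<lambda>x. x powr a)"
proof (rule f''_le0_imp_concave[OF _ powr_has_second_derivative])
  show "a * (a - 1) * x powr (a - 2) \<le> 0" for x :: real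
    using assms by (intro mult_nonpos_nonneg[of "a * (a - 1)"]) (auto simp: mult_le_0_iff)
qed auto

text \<open>Jensen's inequality yields \<open>n\<close> times the power of the mean \<open>s/n\<close>; this brings it to the
  form of the bound.\<close>

lemma card_times_mean_powr:
  fixes n s a :: real
  assumes "n > 0" "s \<ge> 0"
  shows "n powr (1 - a) * s powr a = n * (s / n) powr a"
  using assms by (simp add: powr_diff powr_divide)

lemma power_sum_ge_mean:
  fixes f :: "'b \<Rightarrow> real"
  assumes "finite A" "A \<noteq> {}" and pos: "\<And>i. i \<in> A \<Longrightarrow> f i > 0" and a: "a < 0 \<or> a > 1"
  shows "real (card A) powr (1 - a) * sum f A powr a \<le> (\<Sum>i\<in>A. f i powr a)"
proof -
  have n: "real (card A) > 0"
    using assms by (simp add: card_gt_0_iff)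
  have "(\<Sum>i\<in>A. (1 / real (card A)) *\<^sub>R f i) powr a \<le> (\<Sum>i\<in>A. (1 / real (card A)) * f i powr a)"
    using assms n by (intro convex_on_sum[OF _ _ convex_on_powr[OF a]]) auto
  then have "(sum f A / real (card A)) powr a \<le> (\<Sum>i\<in>A. f i powr a) / real (card A)"
    by (simp add: sum_divide_distrib)
  then have "real (card A) * (sum f A / real (card A)) powr a \<le> (\<Sum>i\<in>A. f i powr a)"
    using n by (simp add: pos_le_divide_eq mult.commute)
  then show ?thesis
    using n pos by (simp add: card_times_mean_powr sum_nonneg less_imp_le)
qed

lemma power_sum_le_mean:
  fixes f :: "'b \<Rightarrow> real"
  assumes "finite A" "A \<noteq> {}" and pos: "\<And>i. i \<in> A \<Longrightarrow> f i > 0" and a: "0 < a" "a < 1"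
  shows "(\<Sum>i\<in>A. f i powr a) \<le> real (card A) powr (1 - a) * sum f A powr a"
proof -
  have n: "real (card A) > 0"
    using assms by (simp add: card_gt_0_iff)
  have "(\<Sum>i\<in>A. (1 / real (card A)) * f i powr a) \<le> (\<Sum>i\<in>A. (1 / real (card A)) *\<^sub>R f i) powr a"
    using assms n by (intro concave_on_sum[OF _ _ concave_on_powr[OF a]]) auto
  then have "(\<Sum>i\<in>A. f i powr a) / real (card A) \<le> (sum f A / real (card A)) powr a"
    by (simp add: sum_divide_distrib)
  then have "(\<Sum>i\<in>A. f i powr a) \<le> real (card A) * (sum f A / real (card A)) powr a"
    using n by (simp add: pos_divide_le_eq mult.commute)
  then show ?thesis
    using n pos by (simp add: card_times_mean_powr sum_nonneg less_imp_le)
qed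

lemma power_sum_eq_mean:
  fixes f :: "'b \<Rightarrow> real"
  assumes "finite A" "A \<noteq> {}" and pos: "\<And>i. i \<in> A \<Longrightarrow> f i > 0"
    and const: "\<And>i j. i \<in> A \<Longrightarrow> j \<in> A \<Longrightarrow> f i = f j"
  shows "(\<Sum>i\<in>A. f i powr a) = real (card A) powr (1 - a) * sum f A powr a"
proof -
  obtain k where k: "k \<in> A"
    using assms(2) by blast
  have n: "real (card A) > 0"
    using assms(1,2) by (simp add: card_gt_0_iff)
  have f: "f i = f k" if "i \<in> A" for i
    by (rule const[OF that k])
  have "(\<Sum>i\<in>A. f i powr a) = (\<Sum>i\<in>A. f k powr a)"
    by (rule sum.cong) (use f in auto)
  moreover have "sum f A = (\<Sum>i\<in>A. f k)"
    by (rule sum.cong) (use f in auto)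
  ultimately have "(\<Sum>i\<in>A. f i powr a) = real (card A) * f k powr a"
    and "sum f A = real (card A) * f k"
    by simp_all
  then show ?thesis
    using n pos[OF k] by (simp add: card_times_mean_powr)
qed

section \<open>Double counting of vertex-edge incidences\<close>

lemma simple_graph_finite_edges:
  assumes "simple_graph V E"
  shows "finite E"
  using assms by (auto simp: simple_graph_def intro: finite_subset[of _ "Pow V"])

text \<open>Both graph sums below exchange a sum over vertices with a sum over edges.\<close>

lemma sum_incidence_swap:
  fixes g :: "'a \<Rightarrow> 'a set \<Rightarrow> int"
  assumes "simple_graph V E"
  shows "(\<Sum>v\<in>V. \<Sum>e\<in>{e \<in> E. v \<in> e}. g v e) = (\<Sum>e\<in>E. \<Sum>v\<in>e. g v e)"
proof -
  have V: "finite V"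
    using assms by (simp add: simple_graph_def)
  have "(\<Sum>v\<in>V. \<Sum>e\<in>{e \<in> E. v \<in> e}. g v e) = (\<Sum>e\<in>E. \<Sum>v\<in>{v \<in> V. v \<in> e}. g v e)"
    by (rule sum.swap_restrict[OF V simple_graph_finite_edges[OF assms]])
  also have "\<dots> = (\<Sum>e\<in>E. \<Sum>v\<in>e. g v e)"
  proof (rule sum.cong)
    fix e assume "e \<in> E"
    then have "{v \<in> V. v \<in> e} = e"
      using assms by (auto simp: simple_graph_def)
    then show "(\<Sum>v\<in>{v \<in> V. v \<in> e}. g v e) = (\<Sum>v\<in>e. g v e)"
      by simp
  qed simp
  finally show ?thesis .
qed

lemma sum_edge_degree:
  assumes "simple_graph V E"
  shows "(\<Sum>e\<in>E. edge_degree E e) = int (first_zagreb V E) - 2 * int (card E)"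
proof -
  have "(\<Sum>e\<in>E. \<Sum>u\<in>e. int (degree E u)) = (\<Sum>u\<in>V. \<Sum>e\<in>{e \<in> E. u \<in> e}. int (degree E u))"
    by (rule sum_incidence_swap[OF assms, symmetric])
  also have "\<dots> = int (first_zagreb V E)"
    by (simp add: first_zagreb_def degree_def power2_eq_square)
  finally show ?thesis
    by (simp add: edge_degree_def sum_subtractf)
qed

lemma sum_edge_nbhd_degree:
  assumes "simple_graph V E"
  shows "(\<Sum>v\<in>V. edge_nbhd_degree E v) = 2 * int (first_zagreb V E) - 4 * int (card E)"
proof -
  have "(\<Sum>v\<in>V. edge_nbhd_degree E v) = (\<Sum>e\<in>E. \<Sum>v\<in>e. edge_degree E e)"
    unfolding edge_nbhd_degree_def by (rule sum_incidence_swap[OF assms])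
  also have "\<dots> = (\<Sum>e\<in>E. 2 * edge_degree E e)"
    using assms by (intro sum.cong) (auto simp: simple_graph_def)
  also have "\<dots> = 2 * (\<Sum>e\<in>E. edge_degree E e)"
    by (simp add: sum_distrib_left)
  finally show ?thesis
    by (simp add: sum_edge_degree[OF assms])
qed

section \<open>Positivity of the edge neighbourhood degrees\<close>

text \<open>A set that no edge leaves contains, with one vertex, everything reachable from it. Applied to
  a set that is too small, this shows that a graph is not connected.\<close>

lemma connected_graph_closed_set:
  assumes "connected_graph V E" and "u \<in> V" "u \<in> C"
    and closed: "\<And>x y. x \<in> C \<Longrightarrow> {x, y} \<in> E \<Longrightarrow> y \<in> C"
  shows "V \<subseteq> C"
proof
  fix v assume "v \<in> V"
  then have "(u, v) \<in> (adj_rel E)\<^sup>*"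
    using assms by (simp add: connected_graph_def)
  then show "v \<in> C"
    by (induction rule: rtrancl_induct) (use assms in \<open>auto simp: adj_rel_def\<close>)
qed

lemma vertex_has_edge:
  assumes "simple_graph V E" "connected_graph V E" "card V \<ge> 2" "v \<in> V"
  obtains e where "e \<in> E" "v \<in> e"
proof (rule ccontr)
  assume "\<not> thesis"
  then have "\<And>e. e \<in> E \<Longrightarrow> v \<notin> e"
    using that by blast
  then have "V \<subseteq> {v}"
    by (intro connected_graph_closed_set[OF assms(2,4)]) auto
  then have "card V \<le> 1"
    using card_mono[of "{v}" V] by simp
  then show False
    using assms(3) by simp
qed

text \<open>
  An edge of degree at most \<open>0\<close> has two ends of degree \<open>1\<close>, so it is the only edge at either
  end and its ends form a component.
\<close>

lemma edge_degree_pos: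
  assumes "simple_graph V E" "connected_graph V E" "card V \<ge> 3" "e \<in> E"
  shows "edge_degree E e > 0"
proof (rule ccontr)
  assume neg: "\<not> edge_degree E e > 0"
  obtain u w where e: "e = {u, w}" "u \<noteq> w"
    using assms by (auto simp: simple_graph_def card_2_iff)
  have uV: "u \<in> V"
    using assms e by (auto simp: simple_graph_def)
  have fin: "finite {e' \<in> E. x \<in> e'}" for x
    using simple_graph_finite_edges[OF assms(1)] by simp
  have deg: "degree E x \<ge> 1" if "x \<in> e" for x
    using that assms(4) fin[of x] card_gt_0_iff[of "{e' \<in> E. x \<in> e'}"]
    by (auto simp: degree_def Suc_le_eq)
  have "degree E x = 1" if "x \<in> e" for x
    using neg deg[of u] deg[of w] that e by (auto simp: edge_degree_def)
  then have only: "e' = e" if "x \<in> e" "e' \<in> E" "x \<in> e'" for x e'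
    using that assms(4) card_le_Suc0_iff_eq[OF fin[of x]] by (auto simp: degree_def)
  have "V \<subseteq> e"
  proof (rule connected_graph_closed_set[OF assms(2) uV])
    show "u \<in> e"
      using e by simp
    show "y \<in> e" if "x \<in> e" "{x, y} \<in> E" for x y
      using only[OF that] by auto
  qed
  then have "card V \<le> 2"
    using card_mono[of e V] e by simp
  then show False
    using assms(3) by simp
qed

lemma edge_nbhd_degree_pos:
  assumes "simple_graph V E" "connected_graph V E" "card V \<ge> 3" "v \<in> V"
  shows "edge_nbhd_degree E v > 0"
proof -
  obtain e where "e \<in> E" "v \<in> e"
    using vertex_has_edge[OF assms(1,2) _ assms(4)] assms(3) by auto
  then show ?thesis
    unfolding edge_nbhd_degree_def
    using simple_graph_finite_edges[OF assms(1)] edge_degree_pos[OF assms(1-3)]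
    by (intro sum_pos) auto
qed

section \<open>Bounds on the general Kulli-Basava index\<close>

theorem theorem3p10:
  fixes V :: "'a set" and E :: "'a set set" and n m M1 :: nat and a :: real
  assumes "simple_graph V E" and "connected_graph V E"
    and "n = card V" and "n \<ge> 3" and "m = card E"
    and "M1 = first_zagreb V E"
    and "a \<noteq> 0" and "a \<noteq> 1"
  shows "(a < 0 \<or> a > 1 \<longrightarrow>
            general_kulli_basava a V E
              \<ge> real n powr (1 - a) * (2 * real M1 - 4 * real m) powr a
            \<and> ((\<forall>u\<in>V. \<forall>v\<in>V. edge_nbhd_degree E u = edge_nbhd_degree E v) \<longrightarrow>
                general_kulli_basava a V E
                  = real n powr (1 - a) * (2 * real M1 - 4 * real m) powr a))
       \<and> (0 < a \<and> a < 1 \<longrightarrow>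
            general_kulli_basava a V E
              \<le> real n powr (1 - a) * (2 * real M1 - 4 * real m) powr a
            \<and> ((\<forall>u\<in>V. \<forall>v\<in>V. edge_nbhd_degree E u = edge_nbhd_degree E v) \<longrightarrow>
                general_kulli_basava a V E
                  = real n powr (1 - a) * (2 * real M1 - 4 * real m) powr a))"
proof -
  let ?S = "\<lambda>v. real_of_int (edge_nbhd_degree E v)"
  have V: "finite V" "V \<noteq> {}"
    using assms by (auto simp: simple_graph_def connected_graph_def)
  have pos: "?S v > 0" if "v \<in> V" for v
    using edge_nbhd_degree_pos[of V E v] assms that by simp
  have "sum ?S V = real_of_int (2 * int M1 - 4 * int m)"
    using sum_edge_nbhd_degree[OF assms(1)] assms by (simp flip: of_int_sum)
  then have total: "2 * real M1 - 4 * real m = sum ?S V"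
    by simp
  let ?bound = "real (card V) powr (1 - a) * sum ?S V powr a"
  have lower: "?bound \<le> (\<Sum>v\<in>V. ?S v powr a)" if "a < 0 \<or> a > 1"
    by (rule power_sum_ge_mean[OF V pos that])
  have upper: "(\<Sum>v\<in>V. ?S v powr a) \<le> ?bound" if "0 < a" "a < 1"
    by (rule power_sum_le_mean[OF V pos that])
  have equal: "(\<Sum>v\<in>V. ?S v powr a) = ?bound"
    if "\<forall>u\<in>V. \<forall>v\<in>V. edge_nbhd_degree E u = edge_nbhd_degree E v"
    by (rule power_sum_eq_mean[OF V pos], assumption, rule arg_cong[of _ _ real_of_int])
      (use that in blast)
  show ?thesis
    unfolding general_kulli_basava_def total assms(3)
    using lower upper equal by blast
qed

end
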